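(* Let $\Sigma$ be a finite alphabet and $\mathrm{BOS}\notin\Sigma$. (a) Let $T$ be a fixed-precision future-masked soft attention transformer over $\Sigma$ with values in $\mathbb{F}_{r,s}$ and without positional encodings, with $d$ dimensions. Then for every dimension $k\in[1,d]$ and every value $F\in\mathbb{F}_{r,s}$ there is a $\mathsf{K}_{\mathrm{t}}[\#]$ formula $\Phi$ such that for every nonempty $w\in\Sigma^*$ of length $n$ and every $i\in[1,n]$, the entry $[T(\mathrm{BOS}\cdot w)]_{k,i+1}$ equals $F$ if and only if $w,i\vDash\Phi$. (b) The same holds for fixed-precision future-masked soft attention transformers with sinusoidal positional encodings, with $\Phi$ a formula of $\mathsf{K}_{\mathrm{t}}[\#;\mathsf{MOD}]$.
   Context: Strings are $w=w_1\cdots w_n$, $n\ge1$. The logic $\mathsf{K}_{\mathrm{t}}[\#]$: formulas $F ::= Q_a \mid \lnot F \mid F\land F \mid C\le C \mid \top$ ($a\in\Sigma$), count terms $C ::= \#[F] \mid C+C \mid C-C \mid 1$, interpreted at $i\in[1,n]$: $\#[F]^{w,i}=|\{j\in[1,i]: w,j\vDash F\}|$, $\pm$ and $1$ as usual; $w,i\vDash Q_a$ iff $w_i=a$; $\lnot,\land$ as usual; $w,i\vDash C_1\le C_2$ iff $C_1^{w,i}\le C_2^{w,i}$; $\top$ always holds. $\mathsf{K}_{\mathrm{t}}[\#;\mathsf{MOD}]$ additionally has atomic formulas $\mathsf{MOD}^k_m$ (integers $m\ge1$, $0\le k<m$) with $w,i\vDash\mathsf{MOD}^k_m$ iff $i\equiv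 k \pmod m$. Fixed precision: $\mathbb{F}_{r,s}=\{i/2^s : -2^{r+s}\le i<2^{r+s}\}$ (numbers with $r$ integer bits and $s$ fractional bits, two's complement). A fixed-precision future-masked soft attention transformer is defined like the real-valued one below, except that all parameters and all computed values lie in $\mathbb{F}_{r,s}$: every position-wise operation (embedding, feed-forward, LayerNorm, exponentials of attention scores and their products with values) is a function into $\mathbb{F}_{r,s}$, and the attention output at each position and dimension is the element $F\in\mathbb{F}_{r,s}$ with $F\le \frac{\sum_{j\le i}e_{ij}v_j}{\sum_{j\le i}e_{ij}}<F+2^{-s}$, where $e_{ij}$ are the (fixed-precision) exponentiated scores and $v_j$ the value entries. Real-valued architecture: the input $w$ is processed as $\mathrm{BOS}\cdot w$, column $1$ for $\mathrm{BOS}$ and column $i+1$ for $w_i$; a word embedding $\mathit{WE}:\Sigma\cup\{\mathrm{BOS}\}\to\mathbb{R}^d$ is applied position-wise (plus, in case (b), a sinusoidal positional encoding vector depending on the position); then blocks $B(A)=\mathit{LN}_2(\mathit{FFN}(A')+A')$, $A'=\mathit{LN}_1(\mathit{SA}(A)+A)$ where $\mathit{SA}$ is future-masked softmax attention (scores $s_{ij}=(W^{(Q)}A_{*,i})\cdot(W^{(K)}A_{*,j})/\sqrt d$, output at column $i$ equal to $\sum_{j\le i}\exp(s_{ij})W^{(V)}A_{*,j}/\sum_{j\le i}\exp(s_{ij})$), $\mathit{FFN}$ is a position-wise two-layer ReLU network, and $\mathit{LN}$ is position-wise LayerNorm. Sinusoidal positional encodings are those whose entries are sines/cosines of the position that are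 periodic in the position (so that each entry depends only on the position modulo some fixed integer). *)

theory Defs
  imports "Jordan_Normal_Form.Matrix" "HOL-Number_Theory.Cong" Complex_Main
begin

text \<open>The alphabet is a finite type \<open>'a\<close>, and a string is an \<open>'a list\<close>. One syntax
  covers both logics; \<open>Kt\<close> and \<open>Kt_MOD\<close> below carve out their formulas.\<close>

datatype 'a formula =
    Q 'a
  | MOD nat nat  \<comment> \<open>\<open>MOD k m\<close>: the position is congruent to \<open>k\<close> modulo \<open>m\<close>\<close>
  | Neg "'a formula"
  | And "'a formula" "'a formula"
  | Leq "'a count_term" "'a count_term"
  | Top
and 'a count_term =
    Count "'a formula"
  | Plus "'a count_term" "'a count_term"
  | Minus "'a count_term" "'a count_term"
  | One

text \<open>Positions are \<open>1, \<dots>, length w\<close>; count terms are integers, so \<open>Minus\<close> does not truncate.\<close>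

primrec sat :: "'a list \<Rightarrow> 'a formula \<Rightarrow> nat \<Rightarrow> bool"
  and cnt :: "'a list \<Rightarrow> 'a count_term \<Rightarrow> nat \<Rightarrow> int" where
  "sat w (Q a) = (\<lambda>i. w ! (i - 1) = a)"
| "sat w (MOD k m) = (\<lambda>i. [i = k] (mod m))"
| "sat w (Neg F) = (\<lambda>i. \<not> sat w F i)"
| "sat w (And F G) = (\<lambda>i. sat w F i \<and> sat w G i)"
| "sat w (Leq C D) = (\<lambda>i. cnt w C i \<le> cnt w D i)"
| "sat w Top = (\<lambda>i. True)"
| "cnt w (Count F) = (\<lambda>i. int (card {j \<in> {1..i}. sat w F j}))"
| "cnt w (Plus C D) = (\<lambda>i. cnt w C i + cnt w D i)"
| "cnt w (Minus C D) = (\<lambda>i. cnt w C i - cnt w D i)"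
| "cnt w One = (\<lambda>i. 1)"

primrec mods :: "'a formula \<Rightarrow> (nat \<times> nat) set"
  and mods_ct :: "'a count_term \<Rightarrow> (nat \<times> nat) set" where
  "mods (Q a) = {}"
| "mods (MOD k m) = {(k, m)}"
| "mods (Neg F) = mods F"
| "mods (And F G) = mods F \<union> mods G"
| "mods (Leq C D) = mods_ct C \<union> mods_ct D"
| "mods Top = {}"
| "mods_ct (Count F) = mods F"
| "mods_ct (Plus C D) = mods_ct C \<union> mods_ct D"
| "mods_ct (Minus C D) = mods_ct C \<union> mods_ct D"
| "mods_ct One = {}"

definition Kt :: "'a formula set" where
  "Kt = {\<Phi>. mods \<Phi> = {}}"

definition Kt_MOD :: "'a formula set" where
  "Kt_MOD = {\<Phi>. \<forall>(k, m) \<in> mods \<Phi>. m \<ge> 1 \<and> k < m}"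

definition fp :: "nat \<Rightarrow> nat \<Rightarrow> real set" where
  "fp r s = {real_of_int i / 2 ^ s | i. - (2 ^ (r + s)) \<le> i \<and> i < 2 ^ (r + s)}"

definition fp_vec :: "nat \<Rightarrow> nat \<Rightarrow> nat \<Rightarrow> real vec set" where
  "fp_vec r s n = {v \<in> carrier_vec n. \<forall>k<n. v $ k \<in> fp r s}"

definition fp_mat :: "nat \<Rightarrow> nat \<Rightarrow> nat \<Rightarrow> nat \<Rightarrow> real mat set" where
  "fp_mat r s m n = {A \<in> carrier_mat m n. \<forall>i<m. \<forall>j<n. A $$ (i, j) \<in> fp r s}"

text \<open>The quotient of numerator and denominator in attention is the element \<open>F\<close> of \<open>fp r s\<close> with
  \<open>F \<le> x / y < F + 1 / 2 ^ s\<close>. Such an \<open>F\<close> exists iff \<open>- (2 ^ r) \<le> x / y < 2 ^ r\<close>; outside this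
  range the quotient saturates. If all exponentials have underflowed, \<open>y = 0\<close> and the
  result is \<open>0\<close>.\<close>

definition fp_quot :: "nat \<Rightarrow> nat \<Rightarrow> real \<Rightarrow> real \<Rightarrow> real" where
  "fp_quot r s x y =
     (if y = 0 then 0
      else if x / y < - (2 ^ r) then - (2 ^ r)
      else if x / y \<ge> 2 ^ r then 2 ^ r - 1 / 2 ^ s
      else (THE F. F \<in> fp r s \<and> F \<le> x / y \<and> x / y < F + 1 / 2 ^ s))"

text \<open>Real-valued and fixed-precision transformers share one architecture and differ only in the
  arithmetic it is evaluated with. ReLU needs no field: it maps \<open>fp r s\<close> to itself.\<close>

record arith =
  mat_vec :: "real mat \<Rightarrow> real vec \<Rightarrow> real vec"
  vec_add :: "real vec \<Rightarrow> real vec \<Rightarrow> real vec"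
  score :: "real vec \<Rightarrow> real vec \<Rightarrow> real"
  expo :: "real \<Rightarrow> real"
  mult :: "real \<Rightarrow> real \<Rightarrow> real"
  quot :: "real \<Rightarrow> real \<Rightarrow> real"
  layer_norm :: "real vec \<Rightarrow> real vec \<Rightarrow> real vec \<Rightarrow> real vec"  \<comment> \<open>scale, shift, argument\<close>
  rnd :: "real \<Rightarrow> real"  \<comment> \<open>applied to positional encodings\<close>

definition exact_layer_norm :: "real \<Rightarrow> real vec \<Rightarrow> real vec \<Rightarrow> real vec \<Rightarrow> real vec" where
  "exact_layer_norm \<epsilon> \<gamma> \<beta> x =
     (let n = dim_vec x;
          \<mu> = (\<Sum>k<n. x $ k) / real n;
          var = (\<Sum>k<n. (x $ k - \<mu>)\<^sup>2) / real n
      in vec n (\<lambda>k. (x $ k - \<mu>) / sqrt (var + \<epsilon>) * \<gamma> $ k + \<beta> $ k))"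

definition exact_arith :: "real \<Rightarrow> arith" where
  "exact_arith \<epsilon> = \<lparr>
     mat_vec = (\<lambda>A x. A *\<^sub>v x),
     vec_add = (\<lambda>x y. x + y),
     score = (\<lambda>q k. (q \<bullet> k) / sqrt (real (dim_vec q))),
     expo = exp,
     mult = (\<lambda>x y. x * y),
     quot = (\<lambda>x y. x / y),
     layer_norm = exact_layer_norm \<epsilon>,
     rnd = (\<lambda>x. x)\<rparr>"

text \<open>A fixed-precision arithmetic implements each operation by some function into \<open>fp r s\<close>. No
  particular rounding is imposed (rounding once, or after every intermediate step, in any
  direction), except for the attention quotient.\<close>

definition fp_arith :: "nat \<Rightarrow> nat \<Rightarrow> arith \<Rightarrow> bool" where
  "fp_arith r s ar \<longleftrightarrow>
     (\<forall>m n. \<forall>A \<in> fp_mat r s m n. \<forall>x \<in> fp_vec r s n. mat_vec ar A x \<in> fp_vec r s m) \<and>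
     (\<forall>n. \<forall>x \<in> fp_vec r s n. \<forall>y \<in> fp_vec r s n. vec_add ar x y \<in> fp_vec r s n) \<and>
     (\<forall>n. \<forall>x \<in> fp_vec r s n. \<forall>y \<in> fp_vec r s n. score ar x y \<in> fp r s) \<and>
     (\<forall>x \<in> fp r s. expo ar x \<in> fp r s) \<and>
     (\<forall>x \<in> fp r s. \<forall>y \<in> fp r s. mult ar x y \<in> fp r s) \<and>
     quot ar = fp_quot r s \<and>
     (\<forall>n. \<forall>\<gamma> \<in> fp_vec r s n. \<forall>\<beta> \<in> fp_vec r s n. \<forall>x \<in> fp_vec r s n.
        layer_norm ar \<gamma> \<beta> x \<in> fp_vec r s n) \<and>
     (\<forall>x. rnd ar x \<in> fp r s)"

record block =
  WQ :: "real mat"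
  WK :: "real mat"
  WV :: "real mat"
  W1 :: "real mat"
  b1 :: "real vec"
  W2 :: "real mat"
  b2 :: "real vec"
  gamma1 :: "real vec"
  beta1 :: "real vec"
  gamma2 :: "real vec"
  beta2 :: "real vec"

text \<open>In the word embedding, \<open>None\<close> is BOS. The positional encoding, if present, takes the column
  number (\<open>1\<close> for BOS) and is given exactly; it is rounded when it is added.\<close>

record 'a transformer =
  WE :: "'a option \<Rightarrow> real vec"
  PE :: "(nat \<Rightarrow> real vec) option"
  blocks :: "block list"

text \<open>Activations are lists of columns, so column \<open>i + 1\<close> is \<open>A ! i\<close>.\<close>

definition self_attention :: "arith \<Rightarrow> block \<Rightarrow> real vec list \<Rightarrow> nat \<Rightarrow> real vec" where
  "self_attention ar B A i =
     (let e = (\<lambda>j. expo ar (score ar (mat_vec ar (WQ B) (A ! i)) (mat_vec ar (WK B) (A ! j))));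
          v = (\<lambda>j. mat_vec ar (WV B) (A ! j))
      in vec (dim_row (WV B))
           (\<lambda>k. quot ar (\<Sum>j\<le>i. mult ar (e j) (v j $ k)) (\<Sum>j\<le>i. e j)))"

definition relu :: "real vec \<Rightarrow> real vec" where
  "relu = map_vec (max 0)"

definition ffn :: "arith \<Rightarrow> block \<Rightarrow> real vec \<Rightarrow> real vec" where
  "ffn ar B x =
     vec_add ar (mat_vec ar (W2 B) (relu (vec_add ar (mat_vec ar (W1 B) x) (b1 B)))) (b2 B)"

definition run_block :: "arith \<Rightarrow> block \<Rightarrow> real vec list \<Rightarrow> real vec list" where
  "run_block ar B A =
     map (\<lambda>i. let x = layer_norm ar (gamma1 B) (beta1 B)
                        (vec_add ar (self_attention ar B A i) (A ! i))
              in layer_norm ar (gamma2 B) (beta2 B) (vec_add ar (ffn ar B x) x))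
       [0..<length A]"

definition embed :: "arith \<Rightarrow> 'a transformer \<Rightarrow> 'a option list \<Rightarrow> real vec list" where
  "embed ar T u =
     (case PE T of
        None \<Rightarrow> map (WE T) u
      | Some p \<Rightarrow> map (\<lambda>i. vec_add ar (WE T (u ! i)) (map_vec (rnd ar) (p (i + 1)))) [0..<length u])"

text \<open>The columns of \<open>T(BOS \<cdot> w)\<close>.\<close>

definition run :: "arith \<Rightarrow> 'a transformer \<Rightarrow> 'a list \<Rightarrow> real vec list" where
  "run ar T w = fold (run_block ar) (blocks T) (embed ar T (None # map Some w))"

definition fp_block :: "nat \<Rightarrow> nat \<Rightarrow> nat \<Rightarrow> block \<Rightarrow> bool" where
  "fp_block r s d B \<longleftrightarrow>
     WQ B \<in> fp_mat r s d d \<and> WK B \<in> fp_mat r s d d \<and> WV B \<in> fp_mat r s d d \<and>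
     (\<exists>h. W1 B \<in> fp_mat r s h d \<and> b1 B \<in> fp_vec r s h \<and> W2 B \<in> fp_mat r s d h) \<and>
     b2 B \<in> fp_vec r s d \<and>
     gamma1 B \<in> fp_vec r s d \<and> beta1 B \<in> fp_vec r s d \<and>
     gamma2 B \<in> fp_vec r s d \<and> beta2 B \<in> fp_vec r s d"

definition fp_transformer :: "nat \<Rightarrow> nat \<Rightarrow> nat \<Rightarrow> 'a transformer \<Rightarrow> bool" where
  "fp_transformer r s d T \<longleftrightarrow>
     (\<forall>a. WE T a \<in> fp_vec r s d) \<and> (\<forall>B \<in> set (blocks T). fp_block r s d B)"

text \<open>The phase \<open>\<phi>\<close> makes the notion independent of the number at which columns start.\<close>

definition sinusoidal :: "nat \<Rightarrow> (nat \<Rightarrow> real vec) \<Rightarrow> bool" where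
  "sinusoidal d p \<longleftrightarrow>
     (\<forall>i. p i \<in> carrier_vec d) \<and>
     (\<forall>k<d. (\<exists>\<omega> \<phi>. (\<forall>i. p i $ k = sin (\<omega> * real i + \<phi>)) \<or> (\<forall>i. p i $ k = cos (\<omega> * real i + \<phi>))) \<and>
            (\<exists>m\<ge>1. \<forall>i. p (i + m) $ k = p i $ k))"

lemma fp_quot_eqI:
  assumes "F \<in> fp r s" "F \<le> x / y" "x / y < F + 1 / 2 ^ s" "y \<noteq> 0"
  shows "fp_quot r s x y = F"
proof -
  have uniq: "G = F" if G: "G \<in> fp r s" "G \<le> x / y" "x / y < G + 1 / 2 ^ s" for G
  proof -
    obtain i j :: int where ij: "F = i / 2 ^ s" "G = j / 2 ^ s"
      using assms(1) G(1) unfolding fp_def by blast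
    have "F < G + 1 / 2 ^ s" "G < F + 1 / 2 ^ s" using assms G by linarith+
    then have "real_of_int i < real_of_int j + 1" "real_of_int j < real_of_int i + 1"
      unfolding ij by (simp_all add: field_simps)
    then have "i = j" by linarith
    then show ?thesis by (simp add: ij)
  qed
  obtain i :: int where i: "F = i / 2 ^ s" "- (2 ^ (r + s)) \<le> i" "i < 2 ^ (r + s)"
    using assms(1) by (auto simp: fp_def)
  have "real_of_int (- (2 ^ (r + s))) \<le> i" using i(2) by (simp only: of_int_le_iff)
  then have lo: "- (2 ^ r) \<le> F" by (simp add: i(1) field_simps power_add)
  have "real_of_int (i + 1) \<le> real_of_int (2 ^ (r + s))" using i(3) by (simp only: of_int_le_iff)
  then have hi: "F + 1 / 2 ^ s \<le> 2 ^ r" by (simp add: i(1) field_simps power_add)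
  have "(THE F. F \<in> fp r s \<and> F \<le> x / y \<and> x / y < F + 1 / 2 ^ s) = F"
    using assms uniq by (intro the_equality) blast+
  then show ?thesis using assms lo hi by (auto simp: fp_quot_def)
qed

text \<open>Rounding the exact results, by any rounding function, is a fixed-precision arithmetic.\<close>

definition rounded_arith :: "nat \<Rightarrow> nat \<Rightarrow> (real \<Rightarrow> real) \<Rightarrow> real \<Rightarrow> arith" where
  "rounded_arith r s \<rho> \<epsilon> = (let E = exact_arith \<epsilon> in \<lparr>
     mat_vec = (\<lambda>A x. map_vec \<rho> (mat_vec E A x)),
     vec_add = (\<lambda>x y. map_vec \<rho> (vec_add E x y)),
     score = (\<lambda>x y. \<rho> (score E x y)),
     expo = (\<lambda>x. \<rho> (expo E x)),
     mult = (\<lambda>x y. \<rho> (mult E x y)),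
     quot = fp_quot r s,
     layer_norm = (\<lambda>\<gamma> \<beta> x. map_vec \<rho> (layer_norm E \<gamma> \<beta> x)),
     rnd = \<rho>\<rparr>)"

lemma fp_arith_rounded_arith:
  assumes "\<And>x. \<rho> x \<in> fp r s"
  shows "fp_arith r s (rounded_arith r s \<rho> \<epsilon>)"
  using assms
  by (auto simp: fp_arith_def rounded_arith_def exact_arith_def exact_layer_norm_def
      fp_vec_def fp_mat_def Let_def)

end

(* With fixed precision a column of activations takes only finitely many values, so an attention
   head at position i sees the past only through the numbers of positions j <= i whose column
   takes each given value. Its numerator and denominator are, for each fixed query column,
   integer linear combinations of these counts, up to the factor 2^s. The rounded quotient is
   therefore determined by finitely many linear inequalities between count terms. By induction on
   the blocks, each possible value of a column is defined by a formula; the BOS column does not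
   depend on the input and contributes constants. *)

theory Submission
  imports Defs
begin

section \<open>Definable predicates and count terms\<close>

text \<open>One formula has to serve all words and positions. The set \<open>M\<close> bounds the
  \<open>MOD\<close> atoms it may contain, so both logics are handled by the same lemmas with
  different \<open>M\<close>. Index 0, which will hold BOS, is left unconstrained.\<close>

definition definable :: "(nat \<times> nat) set \<Rightarrow> ('a list \<Rightarrow> nat \<Rightarrow> bool) \<Rightarrow> bool" where
  "definable M P \<longleftrightarrow> (\<exists>\<Phi>. mods \<Phi> \<subseteq> M \<and> (\<forall>w. \<forall>i \<in> {1..length w}. P w i \<longleftrightarrow> sat w \<Phi> i))"

definition definable_int :: "(nat \<times> nat) set \<Rightarrow> ('a list \<Rightarrow> nat \<Rightarrow> int) \<Rightarrow> bool" where
  "definable_int M c \<longleftrightarrow>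
     (\<exists>C. mods_ct C \<subseteq> M \<and> (\<forall>w. \<forall>i \<in> {1..length w}. c w i = cnt w C i))"

lemma definableI:
  assumes "mods \<Phi> \<subseteq> M" "\<And>w i. 1 \<le> i \<Longrightarrow> i \<le> length w \<Longrightarrow> P w i \<longleftrightarrow> sat w \<Phi> i"
  shows "definable M P"
  using assms unfolding definable_def by (intro exI[of _ \<Phi>]) auto

lemma definable_intI:
  assumes "mods_ct C \<subseteq> M" "\<And>w i. 1 \<le> i \<Longrightarrow> i \<le> length w \<Longrightarrow> c w i = cnt w C i"
  shows "definable_int M c"
  using assms unfolding definable_int_def by (intro exI[of _ C]) auto

lemma definable_cong:
  assumes "definable M P" "\<And>w i. 1 \<le> i \<Longrightarrow> i \<le> length w \<Longrightarrow> P' w i \<longleftrightarrow> P w i"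
  shows "definable M P'"
  using assms unfolding definable_def by auto

lemma definable_int_cong:
  assumes "definable_int M c" "\<And>w i. 1 \<le> i \<Longrightarrow> i \<le> length w \<Longrightarrow> c' w i = c w i"
  shows "definable_int M c'"
  using assms unfolding definable_int_def by auto

section \<open>Atoms, Boolean closure and finite case distinctions\<close>

lemma definable_letter: "definable M (\<lambda>w i. w ! (i - 1) = a)"
  by (rule definableI[of "Q a"]) auto

lemma definable_mod:
  assumes "(k, m) \<in> M"
  shows "definable M (\<lambda>w i. [i = k] (mod m))"
  using assms by (intro definableI[of "MOD k m"]) auto

lemma definable_not:
  assumes "definable M P"
  shows "definable M (\<lambda>w i. \<not> P w i)"
proof -
  obtain \<Phi> where "mods \<Phi> \<subseteq> M" "\<forall>w. \<forall>i \<in> {1..length w}. P w i \<longleftrightarrow> sat w \<Phi> i"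
    using assms unfolding definable_def by blast
  then show ?thesis by (intro definableI[of "Neg \<Phi>"]) auto
qed

lemma definable_conj:
  assumes "definable M P" "definable M P'"
  shows "definable M (\<lambda>w i. P w i \<and> P' w i)"
proof -
  obtain \<Phi> \<Psi> where "mods \<Phi> \<subseteq> M" "\<forall>w. \<forall>i \<in> {1..length w}. P w i \<longleftrightarrow> sat w \<Phi> i"
    "mods \<Psi> \<subseteq> M" "\<forall>w. \<forall>i \<in> {1..length w}. P' w i \<longleftrightarrow> sat w \<Psi> i"
    using assms unfolding definable_def by blast
  then show ?thesis by (intro definableI[of "And \<Phi> \<Psi>"]) auto
qed

lemma definable_disj:
  assumes "definable M P" "definable M P'"
  shows "definable M (\<lambda>w i. P w i \<or> P' w i)"
  using definable_not[OF definable_conj[OF definable_not[OF assms(1)] definable_not[OF assms(2)]]]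
  by simp

lemma definable_const: "definable M (\<lambda>w i. b)"
proof (cases b)
  case True
  then show ?thesis by (intro definableI[of Top]) auto
next
  case False
  then show ?thesis by (intro definableI[of "Neg Top"]) auto
qed

lemma definable_if:
  assumes "definable M P" "definable M P'" "definable M R"
  shows "definable M (\<lambda>w i. if P w i then P' w i else R w i)"
  by (rule definable_cong[OF definable_disj[OF definable_conj[OF assms(1,2)]
        definable_conj[OF definable_not[OF assms(1)] assms(3)]]]) simp

lemma definable_ball:
  assumes "finite S" "\<And>x. x \<in> S \<Longrightarrow> definable M (P x)"
  shows "definable M (\<lambda>w i. \<forall>x\<in>S. P x w i)"
  using assms by (induction S) (auto intro: definable_const definable_conj)

lemma definable_bex:
  assumes "finite S" "\<And>x. x \<in> S \<Longrightarrow> definable M (P x)"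
  shows "definable M (\<lambda>w i. \<exists>x\<in>S. P x w i)"
  using assms by (induction S) (auto intro: definable_const definable_disj)

text \<open>A finite case distinction on the value of \<open>f\<close>: inside \<open>R\<close> this
  value may be treated as a constant. In this way quantities computed at the current position, such
  as the query column, enter further formulas.\<close>

lemma definable_subst:
  assumes "finite V" "\<And>w i. 1 \<le> i \<Longrightarrow> i \<le> length w \<Longrightarrow> f w i \<in> V"
    and "\<And>v. v \<in> V \<Longrightarrow> definable M (\<lambda>w i. f w i = v)"
    and "\<And>v. v \<in> V \<Longrightarrow> definable M (R v)"
  shows "definable M (\<lambda>w i. R (f w i) w i)"
proof (rule definable_cong)
  show "definable M (\<lambda>w i. \<exists>v\<in>V. f w i = v \<and> R v w i)"
    using assms by (intro definable_bex definable_conj)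
qed (use assms(2) in auto)

section \<open>Count terms: linear combinations, counts and comparisons\<close>

lemma definable_int_add:
  assumes "definable_int M c" "definable_int M c'"
  shows "definable_int M (\<lambda>w i. c w i + c' w i)"
proof -
  obtain C D where "mods_ct C \<subseteq> M" "\<forall>w. \<forall>i \<in> {1..length w}. c w i = cnt w C i"
    "mods_ct D \<subseteq> M" "\<forall>w. \<forall>i \<in> {1..length w}. c' w i = cnt w D i"
    using assms unfolding definable_int_def by blast
  then show ?thesis by (intro definable_intI[of "Plus C D"]) auto
qed

lemma definable_int_diff:
  assumes "definable_int M c" "definable_int M c'"
  shows "definable_int M (\<lambda>w i. c w i - c' w i)"
proof -
  obtain C D where "mods_ct C \<subseteq> M" "\<forall>w. \<forall>i \<in> {1..length w}. c w i = cnt w C i"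
    "mods_ct D \<subseteq> M" "\<forall>w. \<forall>i \<in> {1..length w}. c' w i = cnt w D i"
    using assms unfolding definable_int_def by blast
  then show ?thesis by (intro definable_intI[of "Minus C D"]) auto
qed

lemma definable_int_one: "definable_int M (\<lambda>w i. 1)"
  by (rule definable_intI[of One]) auto

lemma definable_int_zero: "definable_int M (\<lambda>w i. 0)"
  using definable_int_diff[OF definable_int_one definable_int_one] by simp

text \<open>Count terms have no product, so a fixed integer factor is unfolded into repeated
  addition or, for negative \<open>n\<close>, repeated subtraction.\<close>

lemma definable_int_scale:
  assumes "definable_int M c"
  shows "definable_int M (\<lambda>w i. n * c w i)"
proof (induction n rule: int_induct[where k = 0])
  case base
  then show ?case using definable_int_zero by simp
next
  case (step1 n)
  then show ?case using definable_int_add[OF step1(2) assms] by (simp add: algebra_simps)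
next
  case (step2 n)
  then show ?case using definable_int_diff[OF step2(2) assms] by (simp add: algebra_simps)
qed

lemma definable_int_const: "definable_int M (\<lambda>w i. n)"
  using definable_int_scale[OF definable_int_one, of M n] by simp

lemma definable_int_sum:
  assumes "finite S" "\<And>x. x \<in> S \<Longrightarrow> definable_int M (c x)"
  shows "definable_int M (\<lambda>w i. \<Sum>x\<in>S. c x w i)"
  using assms by (induction S) (auto intro: definable_int_zero definable_int_add)

text \<open>For \<open>i \<le> length w\<close> all counted positions lie between 1 and
  \<open>length w\<close>, where the formula for \<open>P\<close> is correct, so it can be placed
  under the counting operator.\<close>

lemma definable_int_card:
  assumes "definable M P"
  shows "definable_int M (\<lambda>w i. int (card {j \<in> {1..i}. P w j}))"
proof -
  obtain \<Phi> where \<Phi>: "mods \<Phi> \<subseteq> M" "\<forall>w. \<forall>i \<in> {1..length w}. P w i \<longleftrightarrow> sat w \<Phi> i"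
    using assms unfolding definable_def by blast
  have "{j \<in> {1..i}. P w j} = {j \<in> {1..i}. sat w \<Phi> j}" if "i \<le> length w" for w i
    using \<Phi>(2) that by auto
  with \<Phi>(1) show ?thesis by (intro definable_intI[of "Count \<Phi>"]) auto
qed

lemma definable_le:
  assumes "definable_int M c" "definable_int M c'"
  shows "definable M (\<lambda>w i. c w i \<le> c' w i)"
proof -
  obtain C D where "mods_ct C \<subseteq> M" "\<forall>w. \<forall>i \<in> {1..length w}. c w i = cnt w C i"
    "mods_ct D \<subseteq> M" "\<forall>w. \<forall>i \<in> {1..length w}. c' w i = cnt w D i"
    using assms unfolding definable_int_def by blast
  then show ?thesis by (intro definableI[of "Leq C D"]) auto
qed

lemma definable_less:
  assumes "definable_int M c" "definable_int M c'"
  shows "definable M (\<lambda>w i. c w i < c' w i)"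
  using definable_not[OF definable_le[OF assms(2,1)]] by (simp add: not_le)

lemma definable_eq:
  assumes "definable_int M c" "definable_int M c'"
  shows "definable M (\<lambda>w i. c w i = c' w i)"
  using definable_conj[OF definable_le[OF assms] definable_le[OF assms(2,1)]]
  by (simp add: order_eq_iff)

text \<open>Grouping positions by the value of \<open>f\<close> turns the sum into a linear
  combination of counts with fixed weights \<open>G v\<close>. Counting starts at 1, so index 0 is
  split off; its value \<open>b\<close> is the same for every word and adds the constant
  \<open>G b\<close>.\<close>

lemma definable_int_prefix_sum:
  fixes G :: "'b \<Rightarrow> int" and f :: "'a list \<Rightarrow> nat \<Rightarrow> 'b"
  assumes V: "finite V" "\<And>w i. 1 \<le> i \<Longrightarrow> i \<le> length w \<Longrightarrow> f w i \<in> V"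
    and f: "\<And>v. v \<in> V \<Longrightarrow> definable M (\<lambda>w i. f w i = v)"
    and f0: "\<And>w. f w 0 = b"
  shows "definable_int M (\<lambda>w i. \<Sum>j\<le>i. G (f w j))"
proof (rule definable_int_cong)
  show "definable_int M (\<lambda>w i. G b + (\<Sum>v\<in>V. G v * int (card {j \<in> {1..i}. f w j = v})))"
    using assms
    by (intro definable_int_add definable_int_const definable_int_sum definable_int_scale
        definable_int_card)
next
  fix w :: "'a list" and i :: nat
  assume i: "i \<le> length w"
  have "(\<Sum>j\<in>{1..i}. G (f w j)) = (\<Sum>v\<in>V. \<Sum>j\<in>{j \<in> {1..i}. f w j = v}. G (f w j))"
    using V i by (intro sum.group[symmetric]) auto
  also have "\<dots> = (\<Sum>v\<in>V. G v * int (card {j \<in> {1..i}. f w j = v}))"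
    by (intro sum.cong refl) simp
  finally show "(\<Sum>j\<le>i. G (f w j))
      = G b + (\<Sum>v\<in>V. G v * int (card {j \<in> {1..i}. f w j = v}))"
    by (simp add: f0 atMost_atLeast0 sum.atLeast_Suc_atMost)
qed

section \<open>Fixed-precision numbers and quotients\<close>

lemma finite_fp: "finite (fp r s)"
proof -
  have "fp r s = (\<lambda>i. real_of_int i / 2 ^ s) ` {- (2 ^ (r + s))..<2 ^ (r + s)}"
    by (auto simp: fp_def)
  then show ?thesis by simp
qed

text \<open>The number \<open>x * 2 ^ s\<close> is an integer; the floor only moves it to type
  \<open>int\<close>, so that sums of fixed-precision numbers become integer sums over
  \<open>2 ^ s\<close>.\<close>

lemma fp_floor:
  assumes "x \<in> fp r s"
  shows "real_of_int \<lfloor>x * 2 ^ s\<rfloor> / 2 ^ s = x"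
  using assms by (auto simp: fp_def)

lemma fp_bounds:
  assumes "- (2 ^ r) \<le> n / (2::real) ^ s" "n / (2::real) ^ s < 2 ^ r"
  shows "real_of_int n / 2 ^ s \<in> fp r s"
proof -
  have "real_of_int (- (2 ^ (r + s))) \<le> real_of_int n" "real_of_int n < real_of_int (2 ^ (r + s))"
    using assms by (simp_all add: field_simps power_add)
  then have "- (2 ^ (r + s)) \<le> n" "n < 2 ^ (r + s)"
    by (simp_all only: of_int_le_iff of_int_less_iff)
  then show ?thesis unfolding fp_def by blast
qed

lemma zero_in_fp: "0 \<in> fp r s"
  using fp_bounds[of r 0 s] by simp

lemma fp_max_zero: "x \<in> fp r s \<Longrightarrow> max 0 x \<in> fp r s"
  using zero_in_fp by (simp add: max_def)

text \<open>This removes the definite description from the quotient. Every condition on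
  \<open>x / y\<close> has the form \<open>x / y < t\<close> or its negation, which is the shape
  that \<open>definable_quot_less\<close> treats.\<close>

lemma fp_quot_eq_iff:
  "fp_quot r s x y = F \<longleftrightarrow>
     (if y = 0 then F = 0
      else if x / y < - (2 ^ r) then F = - (2 ^ r)
      else if \<not> x / y < 2 ^ r then F = 2 ^ r - 1 / 2 ^ s
      else F \<in> fp r s \<and> \<not> x / y < F \<and> x / y < F + 1 / 2 ^ s)"
  and fp_quot_in_fp: "fp_quot r s x y \<in> fp r s"
proof -
  \<comment> \<open>Rounding \<open>x / y\<close> down to a multiple of \<open>1 / 2 ^ s\<close>
    gives the required element of \<open>fp r s\<close> when the quotient is in range.\<close>
  let ?n = "\<lfloor>x / y * 2 ^ s\<rfloor>"
  have floor: "?n / 2 ^ s \<in> fp r s" "?n / 2 ^ s \<le> x / y" "x / y < ?n / 2 ^ s + 1 / 2 ^ s"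
    if "\<not> x / y < - (2 ^ r)" "x / y < 2 ^ r"
  proof -
    show le: "?n / 2 ^ s \<le> x / y"
      using of_int_floor_le[of "x / y * 2 ^ s"] by (simp add: divide_le_eq)
    have "x / y * 2 ^ s < ?n + 1" by linarith
    then show "x / y < ?n / 2 ^ s + 1 / 2 ^ s"
      by (simp add: add_divide_distrib[symmetric] less_divide_eq)
    have "real_of_int (- (2 ^ (r + s))) \<le> x / y * 2 ^ s"
      using mult_right_mono[of "- (2 ^ r)" "x / y" "2 ^ s"] that by (simp add: power_add)
    then have "- (2 ^ (r + s)) \<le> ?n" by (simp only: le_floor_iff)
    then have "real_of_int (- (2 ^ (r + s))) \<le> ?n" by (simp only: of_int_le_iff)
    then have "- (2 ^ r) \<le> ?n / 2 ^ s" by (simp add: field_simps power_add)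
    with le that show "?n / 2 ^ s \<in> fp r s" by (intro fp_bounds) auto
  qed
  have ex: "\<exists>G \<in> fp r s. G \<le> x / y \<and> x / y < G + 1 / 2 ^ s"
    if "\<not> x / y < - (2 ^ r)" "x / y < 2 ^ r"
    using floor[OF that] by blast
  show "fp_quot r s x y = F \<longleftrightarrow>
     (if y = 0 then F = 0
      else if x / y < - (2 ^ r) then F = - (2 ^ r)
      else if \<not> x / y < 2 ^ r then F = 2 ^ r - 1 / 2 ^ s
      else F \<in> fp r s \<and> \<not> x / y < F \<and> x / y < F + 1 / 2 ^ s)"
  proof (cases "y = 0 \<or> x / y < - (2 ^ r) \<or> \<not> x / y < 2 ^ r")
    case True
    then show ?thesis by (auto simp: fp_quot_def)
  next
    case False
    then obtain G where "G \<in> fp r s" "G \<le> x / y" "x / y < G + 1 / 2 ^ s"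
      using ex by blast
    with False show ?thesis using fp_quot_eqI[of _ r s x y] by (auto simp: not_less)
  qed
  show "fp_quot r s x y \<in> fp r s"
  proof (cases "y = 0 \<or> x / y < - (2 ^ r) \<or> \<not> x / y < 2 ^ r")
    case True
    \<comment> \<open>The two saturation values are the least and the greatest element of
      \<open>fp r s\<close>.\<close>
    have "real_of_int (- (2 ^ (r + s))) / 2 ^ s \<in> fp r s"
      unfolding fp_def by (rule CollectI, rule exI[of _ "- (2 ^ (r + s))"]) simp
    then have "- (2 ^ r) \<in> fp r s" by (simp add: power_add)
    moreover have "real_of_int (2 ^ (r + s) - 1) / 2 ^ s \<in> fp r s"
      unfolding fp_def
      by (rule CollectI, rule exI[of _ "2 ^ (r + s) - 1"])
        (use one_le_power[of "2::int" "r + s"] in linarith)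
    then have "2 ^ r - 1 / 2 ^ s \<in> fp r s" by (simp add: power_add diff_divide_distrib)
    ultimately show ?thesis using True zero_in_fp by (auto simp: fp_quot_def)
  next
    case False
    then obtain G where "G \<in> fp r s" "G \<le> x / y" "x / y < G + 1 / 2 ^ s"
      using ex by blast
    with False show ?thesis using fp_quot_eqI[of G r s x y] by simp
  qed
qed

text \<open>Denominators may be negative, since fixed-precision exponentials are arbitrary.\<close>

lemma definable_quot_less:
  assumes "definable_int M c" "definable_int M e"
  shows "definable M (\<lambda>w i. real_of_int (c w i) / real_of_int (e w i) < real_of_int n / 2 ^ s)"
proof (rule definable_cong)
  \<comment> \<open>Cross-multiplication, reversed for a negative denominator. In the last branch
    the denominator is 0, so the quotient is 0 by the convention for division and is compared with
    \<open>n / 2 ^ s\<close>.\<close>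
  show "definable M (\<lambda>w i. if 0 < e w i then 2 ^ s * c w i < n * e w i
                           else if e w i < 0 then n * e w i < 2 ^ s * c w i
                           else 0 < n)"
    using assms
    by (intro definable_if definable_less definable_int_const definable_int_scale definable_const)
next
  fix w :: "'a list" and i :: nat
  have cast: "real_of_int (2 ^ s * c w i) < real_of_int (n * e w i) \<longleftrightarrow> 2 ^ s * c w i < n * e w i"
    "real_of_int (n * e w i) < real_of_int (2 ^ s * c w i) \<longleftrightarrow> n * e w i < 2 ^ s * c w i"
    by (simp_all only: of_int_less_iff)
  show "real_of_int (c w i) / real_of_int (e w i) < real_of_int n / 2 ^ s \<longleftrightarrow>
      (if 0 < e w i then 2 ^ s * c w i < n * e w i
       else if e w i < 0 then n * e w i < 2 ^ s * c w i else 0 < n)"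
    unfolding cast[symmetric]
    by (cases "e w i" "0::int" rule: linorder_cases)
      (auto simp: divide_less_eq less_divide_eq mult.commute mult.left_commute zero_less_divide_iff)
qed

text \<open>Numerator and denominator carry the same factor \<open>1 / 2 ^ s\<close>, which cancels.
  What remains is a zero test and the location of a ratio of integers among finitely many constant
  thresholds.\<close>

lemma definable_fp_quot:
  assumes "definable_int M c" "definable_int M e"
  shows "definable M (\<lambda>w i. fp_quot r s (c w i / 2 ^ s) (e w i / 2 ^ s) = F)"
proof (cases "F \<in> fp r s")
  case False
  then have "fp_quot r s x y \<noteq> F" for x y
    using fp_quot_in_fp by metis
  then show ?thesis using definable_const[of M False] by simp
next
  case True
  then obtain n :: int where n: "F = n / 2 ^ s"
    by (auto simp: fp_def)
  define q where "q w i = real_of_int (c w i) / real_of_int (e w i)" for w i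
  have less: "definable M (\<lambda>w i. q w i < real_of_int n / 2 ^ s)" for n
    unfolding q_def by (rule definable_quot_less[OF assms])
  \<comment> \<open>The thresholds are written as integers over \<open>2 ^ s\<close> to fit
    \<open>less\<close>. The conjunct \<open>True\<close> stands for \<open>F \<in> fp r s\<close>,
    and the equations on \<open>F\<close> are constants.\<close>
  have "definable M (\<lambda>w i. if e w i = 0 then F = 0
      else if q w i < real_of_int (- (2 ^ (r + s))) / 2 ^ s then F = - (2 ^ r)
      else if \<not> q w i < real_of_int (2 ^ (r + s)) / 2 ^ s then F = 2 ^ r - 1 / 2 ^ s
      else True \<and> \<not> q w i < real_of_int n / 2 ^ s \<and> q w i < real_of_int (n + 1) / 2 ^ s)"
    by (intro definable_if definable_eq definable_const definable_conj definable_not less assms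
        definable_int_const)
  then show ?thesis
    by (rule definable_cong) (use True in \<open>simp add: fp_quot_eq_iff n q_def power_add add_divide_distrib\<close>)
qed

section \<open>Columns of activations\<close>

lemma finite_fp_vec: "finite (fp_vec r s d)"
proof (rule finite_subset)
  show "fp_vec r s d \<subseteq> (\<lambda>xs. vec_of_list xs) ` {xs. set xs \<subseteq> fp r s \<and> length xs = d}"
  proof
    fix v
    assume "v \<in> fp_vec r s d"
    then have "list_of_vec v \<in> {xs. set xs \<subseteq> fp r s \<and> length xs = d}"
      by (auto simp: fp_vec_def set_list_of_vec vec_set_def)
    then show "v \<in> (\<lambda>xs. vec_of_list xs) ` {xs. set xs \<subseteq> fp r s \<and> length xs = d}"
      by (rule rev_image_eqI) (simp add: vec_list)
  qed
  show "finite ((\<lambda>xs. vec_of_list xs) ` {xs. set xs \<subseteq> fp r s \<and> length xs = d})"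
    by (intro finite_imageI finite_lists_length_eq finite_fp)
qed

lemma definable_vec_eq:
  assumes "\<And>w i. 1 \<le> i \<Longrightarrow> i \<le> length w \<Longrightarrow> dim_vec (f w i) = d" "dim_vec v = d"
    and "\<And>k. k < d \<Longrightarrow> definable M (\<lambda>w i. f w i $ k = v $ k)"
  shows "definable M (\<lambda>w i. f w i = v)"
proof (rule definable_cong)
  show "definable M (\<lambda>w i. \<forall>k\<in>{..<d}. f w i $ k = v $ k)"
    using assms(3) by (intro definable_ball) auto
qed (use assms(1,2) in \<open>auto intro!: eq_vecI\<close>)

text \<open>The invariant carried through the blocks. Index 0 is the BOS column, so
  \<open>A w ! i\<close> belongs to the letter at position \<open>i\<close> without a shift.
  Formulas cannot speak about index 0, hence the demand that its column be the same for all
  words.\<close>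

definition definable_columns ::
    "(nat \<times> nat) set \<Rightarrow> real vec set \<Rightarrow> ('a list \<Rightarrow> real vec list) \<Rightarrow> bool" where
  "definable_columns M V A \<longleftrightarrow>
     (\<forall>w. length (A w) = Suc (length w)) \<and>
     (\<forall>w. \<forall>i \<le> length w. A w ! i \<in> V) \<and>
     (\<exists>b. \<forall>w. A w ! 0 = b) \<and>
     (\<forall>v \<in> V. definable M (\<lambda>w i. A w ! i = v))"

section \<open>The operations of a block\<close>

lemma relu_fp_vec: "x \<in> fp_vec r s n \<Longrightarrow> relu x \<in> fp_vec r s n"
  by (auto simp: relu_def fp_vec_def fp_max_zero)

lemma ffn_fp_vec:
  assumes "fp_arith r s ar" "fp_block r s d B" "x \<in> fp_vec r s d"
  shows "ffn ar B x \<in> fp_vec r s d"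
proof -
  obtain h where h: "W1 B \<in> fp_mat r s h d" "b1 B \<in> fp_vec r s h" "W2 B \<in> fp_mat r s d h"
    using assms(2) unfolding fp_block_def by blast
  have b2: "b2 B \<in> fp_vec r s d" using assms(2) unfolding fp_block_def by blast
  have mv: "mat_vec ar W y \<in> fp_vec r s m" if "W \<in> fp_mat r s m n" "y \<in> fp_vec r s n" for W y m n
    using assms(1) that unfolding fp_arith_def by blast
  have va: "vec_add ar x y \<in> fp_vec r s n" if "x \<in> fp_vec r s n" "y \<in> fp_vec r s n" for x y n
    using assms(1) that unfolding fp_arith_def by blast
  show ?thesis
    unfolding ffn_def by (intro va[OF mv[OF h(3) relu_fp_vec[OF va[OF mv[OF h(1)] h(2)]]] b2] assms(3))
qed

text \<open>With the query column fixed to \<open>v\<close>, each summand is a function of the key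
  column alone, so numerator and denominator fall under \<open>definable_int_prefix_sum\<close>. The
  actual query column takes finitely many definable values and is then substituted for
  \<open>v\<close>.\<close>

lemma definable_attention:
  assumes ar: "fp_arith r s ar" and B: "fp_block r s d B"
    and A: "definable_columns M (fp_vec r s d) A" and x: "x \<in> fp_vec r s d"
  shows "definable M (\<lambda>w i. self_attention ar B (A w) i = x)"
proof -
  let ?V = "fp_vec r s d"
  have col: "A w ! i \<in> ?V" if "i \<le> length w" for w i
    using A that unfolding definable_columns_def by blast
  have col_def: "definable M (\<lambda>w i. A w ! i = v)" if "v \<in> ?V" for v
    using A that unfolding definable_columns_def by blast
  obtain b where b: "\<And>w. A w ! 0 = b"
    using A unfolding definable_columns_def by blast
  have W: "WQ B \<in> fp_mat r s d d" "WK B \<in> fp_mat r s d d" "WV B \<in> fp_mat r s d d"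
    using B unfolding fp_block_def by blast+
  have mv: "mat_vec ar W y \<in> ?V" if "W \<in> fp_mat r s d d" "y \<in> ?V" for W y
    using ar that unfolding fp_arith_def by blast
  define e where "e v u = expo ar (score ar (mat_vec ar (WQ B) v) (mat_vec ar (WK B) u))" for v u
  define m where "m k v u = mult ar (e v u) (mat_vec ar (WV B) u $ k)" for k v u
  have e: "e v u \<in> fp r s" if "v \<in> ?V" "u \<in> ?V" for v u
    using ar mv[OF W(1) that(1)] mv[OF W(2) that(2)] unfolding fp_arith_def e_def by blast
  have m: "m k v u \<in> fp r s" if "v \<in> ?V" "u \<in> ?V" "k < d" for k v u
  proof -
    have "mat_vec ar (WV B) u $ k \<in> fp r s"
      using mv[OF W(3) that(2)] that(3) unfolding fp_vec_def by blast
    then show ?thesis using ar e[OF that(1,2)] unfolding fp_arith_def m_def by blast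
  qed
  have sa: "self_attention ar B (A w) i
      = vec d (\<lambda>k. fp_quot r s (\<Sum>j\<le>i. m k (A w ! i) (A w ! j)) (\<Sum>j\<le>i. e (A w ! i) (A w ! j)))"
    for w i
  proof -
    have "dim_row (WV B) = d" "quot ar = fp_quot r s"
      using W(3) ar by (auto simp: fp_mat_def fp_arith_def)
    then show ?thesis by (simp add: self_attention_def m_def e_def Let_def)
  qed
  \<comment> \<open>The sums are exact and may leave \<open>fp r s\<close>, but they remain integer
    multiples of \<open>1 / 2 ^ s\<close>.\<close>
  have scaled: "(\<Sum>j\<le>i. g (A w ! j)) = real_of_int (\<Sum>j\<le>i. \<lfloor>g (A w ! j) * 2 ^ s\<rfloor>) / 2 ^ s"
    if "i \<le> length w" "\<And>u. u \<in> ?V \<Longrightarrow> g u \<in> fp r s" for g w i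
  proof -
    have "(\<Sum>j\<le>i. g (A w ! j)) = (\<Sum>j\<le>i. real_of_int \<lfloor>g (A w ! j) * 2 ^ s\<rfloor> / 2 ^ s)"
      using that(1) by (intro sum.cong refl fp_floor[where r = r, symmetric] that(2) col) simp
    then show ?thesis by (simp add: sum_divide_distrib)
  qed
  have int_def: "definable_int M (\<lambda>w i. \<Sum>j\<le>i. \<lfloor>g (A w ! j) * 2 ^ s\<rfloor>)" for g
    by (rule definable_int_prefix_sum[where V = ?V and b = b and f = "\<lambda>w i. A w ! i"])
      (use finite_fp_vec col col_def b in auto)
  show ?thesis
  proof (rule definable_vec_eq)
    fix k
    assume k: "k < d"
    have "definable M (\<lambda>w i. fp_quot r s (\<Sum>j\<le>i. m k v (A w ! j)) (\<Sum>j\<le>i. e v (A w ! j)) = x $ k)"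
      if "v \<in> ?V" for v
      by (rule definable_cong[OF definable_fp_quot[OF int_def[of "m k v"] int_def[of "e v"]]])
        (simp only: scaled[where g = "m k v"] scaled[where g = "e v"] m[OF that _ k] e[OF that])
    then have "definable M (\<lambda>w i. fp_quot r s (\<Sum>j\<le>i. m k (A w ! i) (A w ! j))
        (\<Sum>j\<le>i. e (A w ! i) (A w ! j)) = x $ k)"
      by (intro definable_subst[where V = ?V and f = "\<lambda>w i. A w ! i" and
            R = "\<lambda>v w i. fp_quot r s (\<Sum>j\<le>i. m k v (A w ! j)) (\<Sum>j\<le>i. e v (A w ! j)) = x $ k"])
        (use finite_fp_vec col col_def in auto)
    then show "definable M (\<lambda>w i. self_attention ar B (A w) i $ k = x $ k)"
      by (simp add: sa k)
  next
    show "dim_vec x = d" using x by (auto simp: fp_vec_def)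
  qed (simp add: sa)
qed

text \<open>Saturation and the default 0 keep every value of \<open>fp_quot\<close> in
  \<open>fp r s\<close>, whatever the columns of \<open>A\<close> hold.\<close>

lemma self_attention_fp_vec:
  assumes "fp_arith r s ar" "fp_block r s d B"
  shows "self_attention ar B A i \<in> fp_vec r s d"
proof -
  have "dim_row (WV B) = d" "quot ar = fp_quot r s"
    using assms by (auto simp: fp_block_def fp_mat_def fp_arith_def)
  then show ?thesis by (simp add: self_attention_def fp_vec_def fp_quot_in_fp Let_def)
qed

text \<open>Apart from attention a block acts position-wise: its output is \<open>post\<close> of
  the attention output and the residual column. Both range over a finite set of definable values, so
  two substitutions suffice.\<close>

lemma definable_run_block:
  assumes ar: "fp_arith r s ar" and B: "fp_block r s d B"
    and A: "definable_columns M (fp_vec r s d) A"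
  shows "definable_columns M (fp_vec r s d) (\<lambda>w. run_block ar B (A w))"
proof -
  let ?V = "fp_vec r s d"
  have len: "length (A w) = Suc (length w)" for w
    using A unfolding definable_columns_def by blast
  have col: "A w ! i \<in> ?V" if "i \<le> length w" for w i
    using A that unfolding definable_columns_def by blast
  have col_def: "definable M (\<lambda>w i. A w ! i = v)" if "v \<in> ?V" for v
    using A that unfolding definable_columns_def by blast
  obtain b where b: "\<And>w. A w ! 0 = b"
    using A unfolding definable_columns_def by blast
  define post where "post y v =
      (let x = layer_norm ar (gamma1 B) (beta1 B) (vec_add ar y v)
       in layer_norm ar (gamma2 B) (beta2 B) (vec_add ar (ffn ar B x) x))" for y v
  have run: "run_block ar B (A w) ! i = post (self_attention ar B (A w) i) (A w ! i)"
    if "i \<le> length w" for w i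
    using that by (simp add: run_block_def post_def len nth_append del: upt_Suc)
  have va: "vec_add ar x y \<in> ?V" if "x \<in> ?V" "y \<in> ?V" for x y
    using ar that unfolding fp_arith_def by blast
  have ln: "layer_norm ar (gamma1 B) (beta1 B) x \<in> ?V" "layer_norm ar (gamma2 B) (beta2 B) x \<in> ?V"
    if "x \<in> ?V" for x
    using ar B that unfolding fp_arith_def fp_block_def by blast+
  have post: "post y v \<in> ?V" if "y \<in> ?V" "v \<in> ?V" for y v
    unfolding post_def Let_def by (intro ln va ffn_fp_vec[OF ar B] that)
  have sa: "self_attention ar B (A w) i \<in> ?V" for w i
    by (rule self_attention_fp_vec[OF ar B])
  have "definable M (\<lambda>w i. run_block ar B (A w) ! i = x)" for x
  proof (rule definable_cong)
    have "definable M (\<lambda>w i. post y (A w ! i) = x)" if "y \<in> ?V" for y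
      by (rule definable_subst[where V = ?V and f = "\<lambda>w i. A w ! i" and R = "\<lambda>v w i. post y v = x"])
        (use finite_fp_vec col col_def definable_const in auto)
    then show "definable M (\<lambda>w i. post (self_attention ar B (A w) i) (A w ! i) = x)"
      by (intro definable_subst[where V = ?V and f = "\<lambda>w i. self_attention ar B (A w) i" and
            R = "\<lambda>y w i. post y (A w ! i) = x"])
        (use finite_fp_vec sa definable_attention[OF ar B A] in auto)
  qed (simp add: run)
  \<comment> \<open>At index 0 the mask leaves only the BOS column itself, so the output there again
    depends on \<open>b\<close> alone.\<close>
  moreover have "\<exists>c. \<forall>w. run_block ar B (A w) ! 0 = c"
    by (simp add: run self_attention_def b)
  ultimately show ?thesis
    using post sa col by (simp add: definable_columns_def run) (simp add: run_block_def len)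
qed

lemma definable_fold_run_block:
  assumes "fp_arith r s ar" "\<And>B. B \<in> set Bs \<Longrightarrow> fp_block r s d B"
    and "definable_columns M (fp_vec r s d) A"
  shows "definable_columns M (fp_vec r s d) (\<lambda>w. fold (run_block ar) Bs (A w))"
  using assms(2,3)
proof (induction Bs arbitrary: A)
  case (Cons B Bs)
  then show ?case
    using Cons.IH[OF _ definable_run_block[OF assms(1) _ Cons.prems(2)]] by simp
qed simp

section \<open>Embeddings and the final entry\<close>

text \<open>From index 1 on the list holds \<open>Some\<close> of a letter, so a disjunction over
  the finite alphabet defines the value. An arbitrary \<open>f\<close> lets the lemma also cover an
  embedding to which a fixed positional vector is added.\<close>

lemma definable_letter_embedding:
  fixes f :: "'a::finite option \<Rightarrow> 'b"
  shows "definable M (\<lambda>w i. f ((None # map Some w) ! i) = v)"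
proof (rule definable_cong)
  show "definable M (\<lambda>w i. \<exists>a\<in>UNIV. w ! (i - 1) = a \<and> f (Some a) = v)"
    by (intro definable_bex definable_conj definable_letter definable_const) simp
next
  fix w :: "'a list" and i :: nat
  assume "1 \<le> i" "i \<le> length w"
  then show "f ((None # map Some w) ! i) = v \<longleftrightarrow> (\<exists>a\<in>UNIV. w ! (i - 1) = a \<and> f (Some a) = v)"
    by (cases i) auto
qed

lemma definable_columns_embed_no_position:
  fixes T :: "'a::finite transformer"
  assumes T: "fp_transformer r s d T" and "PE T = None"
  shows "definable_columns M (fp_vec r s d) (\<lambda>w. embed ar T (None # map Some w))"
proof -
  have "embed ar T (None # map Some w) ! i = WE T ((None # map Some w) ! i)" if "i \<le> length w"
    for w :: "'a list" and i
    using that assms(2) nth_map[of i "None # map Some w" "WE T"] by (simp add: embed_def)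
  moreover have "WE T a \<in> fp_vec r s d" for a
    using T unfolding fp_transformer_def by blast
  ultimately show ?thesis
    using definable_cong[OF definable_letter_embedding[of M "WE T"]]
    by (simp add: definable_columns_def) (simp add: embed_def assms(2))
qed

text \<open>The value \<open>f i\<close> depends only on the residue of \<open>i\<close> modulo
  \<open>m\<close>, and each residue is recognized by an atom that \<open>M\<close> permits.\<close>

lemma definable_periodic:
  assumes m: "1 \<le> m" "\<And>k. k < m \<Longrightarrow> (k, m) \<in> M" and f: "\<And>i. f (i + m) = f i"
  shows "definable M (\<lambda>w i. f i = x)"
proof (rule definable_cong)
  show "definable M (\<lambda>w i. \<exists>k\<in>{..<m}. [i = k] (mod m) \<and> f k = x)"
    using m by (intro definable_bex definable_conj definable_mod definable_const) auto
next
  fix i :: nat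
  have "f (j + n * m) = f j" for j n
    by (induction n) (simp_all add: f add.assoc[symmetric] add.commute[of m])
  then have "f (i mod m) = f i"
    by (metis mod_mult_div_eq mult.commute)
  then show "f i = x \<longleftrightarrow> (\<exists>k\<in>{..<m}. [i = k] (mod m) \<and> f k = x)"
    using m(1) by (auto simp: cong_def intro!: bexI[of _ "i mod m"])
qed

text \<open>Periods may differ from entry to entry, so \<open>M\<close> contains all residues of all
  moduli. The rounded positional vectors lie in a finite set; after substituting their values only
  the letter varies.\<close>

lemma definable_columns_embed_sinusoidal:
  fixes T :: "'a::finite transformer"
  assumes ar: "fp_arith r s ar" and T: "fp_transformer r s d T"
    and p: "PE T = Some p" "sinusoidal d p"
    and M: "\<And>k m. k < m \<Longrightarrow> (k, m) \<in> M"
  shows "definable_columns M (fp_vec r s d) (\<lambda>w. embed ar T (None # map Some w))"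
proof -
  let ?V = "fp_vec r s d"
  \<comment> \<open>Positional encodings number columns from 1, list indices start at 0. The shift
    by one preserves periods.\<close>
  define pos where "pos i = map_vec (rnd ar) (p (i + 1))" for i
  have emb: "embed ar T (None # map Some w) ! i = vec_add ar (WE T ((None # map Some w) ! i)) (pos i)"
    if "i \<le> length w" for w :: "'a list" and i
    using that p(1) by (simp add: embed_def pos_def nth_append del: upt_Suc)
  have WE: "WE T a \<in> ?V" for a
    using T unfolding fp_transformer_def by blast
  have dim: "dim_vec (p i) = d" for i
    using p(2) unfolding sinusoidal_def by auto
  have rnd: "rnd ar x \<in> fp r s" for x
    using ar unfolding fp_arith_def by blast
  have pos: "pos i \<in> ?V" for i
    unfolding fp_vec_def pos_def
    by (intro CollectI conjI allI impI carrier_vecI) (simp_all only: index_map_vec dim rnd)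
  have pos_def': "definable M (\<lambda>w i. pos i = v)" if "v \<in> ?V" for v
  proof (rule definable_vec_eq)
    fix k
    assume k: "k < d"
    then obtain m where m: "m \<ge> 1" "\<And>i. p (i + m) $ k = p i $ k"
      using p(2) unfolding sinusoidal_def by blast
    show "definable M (\<lambda>w i. pos i $ k = v $ k)"
      using m(2)[of "_ + 1"]
      by (intro definable_periodic[OF m(1) M]) (simp_all add: pos_def dim k ac_simps)
  qed (use that dim in \<open>auto simp: fp_vec_def pos_def\<close>)
  have va: "vec_add ar x y \<in> ?V" if "x \<in> ?V" "y \<in> ?V" for x y
    using ar that unfolding fp_arith_def by blast
  have "definable M (\<lambda>w i. embed ar T (None # map Some w) ! i = v)" for v
  proof (rule definable_cong)
    show "definable M (\<lambda>w i. vec_add ar (WE T ((None # map Some w) ! i)) (pos i) = v)"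
      by (rule definable_subst[where V = ?V and f = "\<lambda>w. pos" and
            R = "\<lambda>x w i. vec_add ar (WE T ((None # map Some w) ! i)) x = v"])
        (use finite_fp_vec pos pos_def'
          definable_letter_embedding[of M "\<lambda>a. vec_add ar (WE T a) _"] in auto)
  qed (simp add: emb)
  then show ?thesis
    using va WE pos by (simp add: definable_columns_def emb) (simp add: embed_def p(1))
qed

text \<open>Once the value of the column is fixed, the equation for its entry is a constant truth
  value.\<close>

lemma definable_entry:
  assumes "definable_columns M (fp_vec r s d) A"
  shows "definable M (\<lambda>w i. A w ! i $ k = F)"
  by (rule definable_subst[where V = "fp_vec r s d" and f = "\<lambda>w i. A w ! i" and
        R = "\<lambda>v w i. v $ k = F"])
    (use assms finite_fp_vec definable_const in \<open>auto simp: definable_columns_def\<close>)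

theorem theorem3:
  fixes ar :: arith and T :: "'a::finite transformer" and r s d :: nat
  assumes "fp_arith r s ar" and "fp_transformer r s d T"
  shows "(PE T = None \<longrightarrow>
            (\<forall>k<d. \<forall>F \<in> fp r s. \<exists>\<Phi> \<in> Kt. \<forall>w. w \<noteq> [] \<longrightarrow>
               (\<forall>i \<in> {1..length w}. (run ar T w ! i) $ k = F \<longleftrightarrow> sat w \<Phi> i))) \<and>
         (\<forall>p. PE T = Some p \<and> sinusoidal d p \<longrightarrow>
            (\<forall>k<d. \<forall>F \<in> fp r s. \<exists>\<Phi> \<in> Kt_MOD. \<forall>w. w \<noteq> [] \<longrightarrow>
               (\<forall>i \<in> {1..length w}. (run ar T w ! i) $ k = F \<longleftrightarrow> sat w \<Phi> i)))"
proof -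
  have blocks: "fp_block r s d B" if "B \<in> set (blocks T)" for B
    using assms(2) that unfolding fp_transformer_def by blast
  have entry: "definable M (\<lambda>w i. run ar T w ! i $ k = F)"
    if "definable_columns M (fp_vec r s d) (\<lambda>w. embed ar T (None # map Some w))" for M k F
    using definable_entry[OF definable_fold_run_block[OF assms(1) blocks that]]
    by (simp add: run_def)
  \<comment> \<open>Taking \<open>M = {}\<close> forces the formula to contain no \<open>MOD\<close>
    atom.\<close>
  have "\<exists>\<Phi> \<in> Kt. \<forall>w. w \<noteq> [] \<longrightarrow>
      (\<forall>i \<in> {1..length w}. (run ar T w ! i) $ k = F \<longleftrightarrow> sat w \<Phi> i)"
    if "PE T = None" for k F
    using entry[OF definable_columns_embed_no_position[OF assms(2) that, where M = "{}"], of k F]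
    unfolding definable_def Kt_def by blast
  moreover have "\<exists>\<Phi> \<in> Kt_MOD. \<forall>w. w \<noteq> [] \<longrightarrow>
      (\<forall>i \<in> {1..length w}. (run ar T w ! i) $ k = F \<longleftrightarrow> sat w \<Phi> i)"
    if "PE T = Some p" "sinusoidal d p" for p k F
  proof -
    have "definable {(k, m). m \<ge> 1 \<and> k < m} (\<lambda>w i. run ar T w ! i $ k = F)"
      by (rule entry[OF definable_columns_embed_sinusoidal[OF assms that]]) auto
    then show ?thesis unfolding definable_def Kt_MOD_def by blast
  qed
  ultimately show ?thesis by blast
qed

end
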